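(* Let $n\geq 2$ be a natural number and write $n=p_1^{n_1}p_2^{n_2}\cdots p_k^{n_k}$ with $p_1,\dots,p_k$ distinct primes and $n_1,\dots,n_k$ positive integers. Then $$Cl_2(\mathbb{Z}_n)\cong\begin{cases}Shu^{2^{k-1}}_{m}(I(\mathbb{Z}_n)), & \text{if } 2\mid n \text{ and } 4\nmid n,\\ Shu^{2^{k+1}}_{m}(I(\mathbb{Z}_n)), & \text{if } 8\mid n,\\ Shu^{2^k}_{m}(I(\mathbb{Z}_n)), & \text{otherwise},\end{cases}$$ where $m=(p_1^{n_1}-p_1^{n_1-1})(p_2^{n_2}-p_2^{n_2-1})\cdots(p_k^{n_k}-p_k^{n_k-1})$.
   Context: $\mathbb{Z}_n$ is the ring of integers modulo $n$. For a ring $R$ with identity, $Id(R)$ is the set of idempotents and $U(R)$ the set of units. The idempotent graph $I(R)$ is the simple undirected graph whose vertices are the nontrivial idempotents of $R$ (those different from $0$ and $1$), where two distinct vertices $x,y$ are adjacent if and only if $xy=yx=0$ (it may have empty vertex set). $Cl_2(R)$ is the simple undirected graph with vertex set $\{(e,u): e\in Id(R)\setminus\{0\},\ u\in U(R)\}$, in which two distinct vertices $(e,u)$ and $(f,v)$ are adjacent if and only if $ef=fe=0$ or $uv=vu=1$. The $(t,n)$-shuriken graph: let $G$ be a simple graph (possibly with no vertices) and let $n,t$ be positive integers with $n-t$ even ($t\le n$ in all uses here). Add a new vertex $z\notin V(G)$ to $G$ and take $n$ copies of the resulting graph; $G'_i$ is the $i$-th copy, with vertex set $V(G'_i)=\{z_i\}\cup\{v_i: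 v\in V(G)\}$. Then $Shu^t_n(G)$ is the simple graph with vertex set $\bigcup_{i=1}^n V(G'_i)$ and edge set $$\{u_iv_j: uv\in E(G),\ i,j\in\{1,\dots,n\}\}\cup\{u_iv_i: u_i,v_i\in V(G'_i),\ u_i\ne v_i,\ i\in\{1,\dots,t\}\}\cup\left\{u_iv_{n+t+1-i}: u_i\in V(G'_i),\ v_{n+t+1-i}\in V(G'_{n+t+1-i}),\ i\in\{t+1,\dots,\tfrac{n+t}{2}\}\right\},$$ where in the last two sets $u$ and $v$ range over $V(G)\cup\{z\}$ (with $u=v$ allowed in the last set). *)

theory Defs
  imports
    "HOL-Number_Theory.Residues"
    "Graph_Theory.Pair_Digraph"
    "Graph_Theory.Digraph_Isomorphism"
begin

text \<open>
  A simple undirected graph is a loop-free symmetric digraph without parallel arcs, each edge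
  being represented by its two arcs. Isomorphism of graphs is
  \<^const>\<open>digraph_iso\<close>; the lemma \<open>digraph_iso_with_proj_iff\<close> below confirms that on
  such graphs it means a bijection of the vertices preserving and reflecting adjacency.
\<close>

definition idempotents :: "('a, 'm) ring_scheme \<Rightarrow> 'a set" where
  "idempotents R = {e \<in> carrier R. e \<otimes>\<^bsub>R\<^esub> e = e}"

definition idempotent_graph :: "('a, 'm) ring_scheme \<Rightarrow> 'a pair_pre_digraph" where
  "idempotent_graph R =
     (let V = idempotents R - {\<zero>\<^bsub>R\<^esub>, \<one>\<^bsub>R\<^esub>}
      in \<lparr> pverts = V,
           parcs = {(x, y). x \<in> V \<and> y \<in> V \<and> x \<noteq> y \<and> x \<otimes>\<^bsub>R\<^esub> y = \<zero>\<^bsub>R\<^esub> \<and> y \<otimes>\<^bsub>R\<^esub> x = \<zero>\<^bsub>R\<^esub>} \<rparr>)"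

definition Cl2 :: "('a, 'm) ring_scheme \<Rightarrow> ('a \<times> 'a) pair_pre_digraph" where
  "Cl2 R =
     (let V = (idempotents R - {\<zero>\<^bsub>R\<^esub>}) \<times> Units R
      in \<lparr> pverts = V,
           parcs = {((e, u), (f, v)) | e u f v.
             (e, u) \<in> V \<and> (f, v) \<in> V \<and> (e, u) \<noteq> (f, v) \<and>
             (e \<otimes>\<^bsub>R\<^esub> f = \<zero>\<^bsub>R\<^esub> \<and> f \<otimes>\<^bsub>R\<^esub> e = \<zero>\<^bsub>R\<^esub> \<or>
              u \<otimes>\<^bsub>R\<^esub> v = \<one>\<^bsub>R\<^esub> \<and> v \<otimes>\<^bsub>R\<^esub> u = \<one>\<^bsub>R\<^esub>)} \<rparr>)"

text \<open>
  In \<open>shuriken t n G\<close>, the \<open>(t,n)\<close>-shuriken graph of \<open>G\<close>, the pair \<open>(Some v, i)\<close> is the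
  copy \<open>v\<^sub>i\<close> of a vertex \<open>v\<close> of \<open>G\<close> and \<open>(None, i)\<close> is the copy \<open>z\<^sub>i\<close> of the added vertex.
  The set \<open>E\<close> lists each edge in at least one direction. The construction is meant for
  \<open>0 < t \<le> n\<close> with \<open>n - t\<close> even, so that the copies \<open>t + 1, \<dots>, n\<close> are matched in pairs.
\<close>

definition shuriken ::
    "nat \<Rightarrow> nat \<Rightarrow> 'a pair_pre_digraph \<Rightarrow> ('a option \<times> nat) pair_pre_digraph" where
  "shuriken t n G =
     (let V = insert None (Some ` pverts G);
          E = {((Some u, i), (Some v, j)) | u v i j.
                 (u, v) \<in> parcs G \<and> i \<in> {1..n} \<and> j \<in> {1..n}}
            \<union> {((u, i), (v, i)) | u v i.
                 u \<in> V \<and> v \<in> V \<and> u \<noteq> v \<and> i \<in> {1..t}}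
            \<union> {((u, i), (v, n + t + 1 - i)) | u v i.
                 u \<in> V \<and> v \<in> V \<and> i \<in> {t + 1..(n + t) div 2}}
      in \<lparr> pverts = V \<times> {1..n}, parcs = E \<union> E\<inverse> \<rparr>)"

lemma digraph_iso_with_proj_iff:
  assumes "pair_wf_digraph G" "pair_wf_digraph H"
  shows "digraph_iso (with_proj G) (with_proj H) \<longleftrightarrow>
    (\<exists>f. bij_betw f (pverts G) (pverts H) \<and>
         (\<forall>u\<in>pverts G. \<forall>v\<in>pverts G. (u, v) \<in> parcs G \<longleftrightarrow> (f u, f v) \<in> parcs H))"
proof
  interpret G: pair_wf_digraph G by fact
  assume "digraph_iso (with_proj G) (with_proj H)"
  then obtain h where h: "pre_digraph.digraph_isomorphism (with_proj G) h"
    and H: "with_proj H = app_iso h (with_proj G)"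
    unfolding digraph_iso_def by blast
  have vs: "pverts H = iso_verts h ` pverts G" and as: "parcs H = iso_arcs h ` parcs G"
    and t: "iso_tail h = fst" and hd: "iso_head h = snd"
    using H by (auto simp: with_proj_def app_iso_def)
  have inj: "inj_on (iso_verts h) (pverts G)"
    and arc: "\<And>a. a \<in> parcs G \<Longrightarrow> iso_arcs h a = (iso_verts h (fst a), iso_verts h (snd a))"
    using h unfolding pre_digraph.digraph_isomorphism_def
    by (auto simp: t hd prod_eq_iff)
  have "(u, v) \<in> parcs G \<longleftrightarrow> (iso_verts h u, iso_verts h v) \<in> parcs H"
    if uv: "u \<in> pverts G" "v \<in> pverts G" for u v
  proof
    show "(u, v) \<in> parcs G \<Longrightarrow> (iso_verts h u, iso_verts h v) \<in> parcs H"
      using arc[of "(u, v)"] unfolding as by (metis fst_conv snd_conv imageI)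
    assume "(iso_verts h u, iso_verts h v) \<in> parcs H"
    then obtain x y where "(x, y) \<in> parcs G" "iso_verts h u = iso_verts h x"
      "iso_verts h v = iso_verts h y"
 proof -
      from \<open>(iso_verts h u, iso_verts h v) \<in> parcs H\<close> obtain b where b: "b \<in> parcs G"
        "iso_arcs h b = (iso_verts h u, iso_verts h v)"
        unfolding as by (metis imageE)
      then have "(fst b, snd b) \<in> parcs G" "iso_verts h u = iso_verts h (fst b)"
        "iso_verts h v = iso_verts h (snd b)"
        using arc[OF b(1)] by simp_all
      then show ?thesis by (rule that)
    qed
    then show "(u, v) \<in> parcs G"
      using inj uv G.in_arcsD1 G.in_arcsD2 by (metis inj_onD)
  qed
  then show "\<exists>f. bij_betw f (pverts G) (pverts H) \<and>
         (\<forall>u\<in>pverts G. \<forall>v\<in>pverts G. (u, v) \<in> parcs G \<longleftrightarrow> (f u, f v) \<in> parcs H)"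
    using inj vs unfolding bij_betw_def by blast
next
  interpret G: pair_wf_digraph G by fact
  interpret H: pair_wf_digraph H by fact
  assume "\<exists>f. bij_betw f (pverts G) (pverts H) \<and>
         (\<forall>u\<in>pverts G. \<forall>v\<in>pverts G. (u, v) \<in> parcs G \<longleftrightarrow> (f u, f v) \<in> parcs H)"
  then obtain f where f: "inj_on f (pverts G)" "pverts H = f ` pverts G"
    and adj: "\<And>u v. u \<in> pverts G \<Longrightarrow> v \<in> pverts G \<Longrightarrow> (u, v) \<in> parcs G \<longleftrightarrow> (f u, f v) \<in> parcs H"
    unfolding bij_betw_def by blast
  define h where "h = \<lparr> iso_verts = f, iso_arcs = map_prod f f,
    iso_head = snd, iso_tail = fst \<rparr>"
  have "inj_on (map_prod f f) (parcs G)"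
  proof (rule inj_onI)
    fix x y assume "x \<in> parcs G" "y \<in> parcs G" "map_prod f f x = map_prod f f y"
    then show "x = y"
      using inj_onD[OF f(1)] G.arc_fst_in_verts G.arc_snd_in_verts
      by (simp add: prod_eq_iff)
  qed
  then have iso: "pre_digraph.digraph_isomorphism (with_proj G) h"
    using f(1) G.wf_digraph by (auto simp: pre_digraph.digraph_isomorphism_def h_def)
  have "parcs H = map_prod f f ` parcs G"
  proof (intro equalityI subsetI)
    fix e assume "e \<in> parcs H"
    moreover from this obtain u v where "u \<in> pverts G" "v \<in> pverts G" "e = (f u, f v)"
      using H.arc_fst_in_verts H.arc_snd_in_verts f(2)
      by (metis imageE prod.collapse)
    ultimately have "(u, v) \<in> parcs G" using adj by simp
    then show "e \<in> map_prod f f ` parcs G" using \<open>e = (f u, f v)\<close> by (metis imageI map_prod_simp)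
  next
    fix e assume "e \<in> map_prod f f ` parcs G"
    then obtain u v where uv: "(u, v) \<in> parcs G" "e = (f u, f v)" by auto
    then show "e \<in> parcs H" using adj[of u v] G.in_arcsD1[OF uv(1)] G.in_arcsD2[OF uv(1)] by blast
  qed
  then have "with_proj H = app_iso h (with_proj G)"
    using f(2) by (simp add: with_proj_def app_iso_def h_def)
  with iso show "digraph_iso (with_proj G) (with_proj H)"
    unfolding digraph_iso_def by blast
qed

lemma pair_bidirected_digraph_idempotent_graph:
  "pair_bidirected_digraph (idempotent_graph R)"
  by unfold_locales (auto simp: idempotent_graph_def Let_def symmetric_def sym_def)

lemma pair_bidirected_digraph_Cl2:
  "pair_bidirected_digraph (Cl2 R)"
  by unfold_locales (auto simp: Cl2_def Let_def symmetric_def sym_def)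

lemma pair_bidirected_digraph_shuriken:
  assumes "pair_bidirected_digraph G" "t \<le> n"
  shows "pair_bidirected_digraph (shuriken t n G)"
proof -
  interpret G: pair_bidirected_digraph G by fact
  show ?thesis
    using assms(2)
    by unfold_locales
      (auto simp: shuriken_def Let_def symmetric_def sym_def
        dest: G.in_arcsD1 G.in_arcsD2 G.pair_no_loops)
qed

end

theory Submission
  imports Defs
begin

text \<open>
  Fix a ring in which one and zero differ and the units are finite in number. Two units multiply
  to one in both orders exactly when they are mutually inverse, so the second condition for
  adjacency in the graph \<open>Cl2\<close> only depends on the involution \<open>u \<mapsto> u\<inverse>\<close> on the
  units. Number the units by \<open>1, \<dots>, m\<close> so that the \<open>t\<close> self-inverse ones come first and
  position \<open>i > t\<close> is inverse to position \<open>m + t + 1 - i\<close>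
  (\<open>involution_enumeration\<close>). Let copy number \<open>i\<close> of the idempotent graph, together with its
  added vertex, carry the pairs whose unit has number \<open>i\<close>; the added vertex stands for the
  idempotent one. The edges of the shuriken inside the first \<open>t\<close> copies and between matched
  copies then say that the two units are inverse to each other. The edges inherited from the
  idempotent graph say that the two idempotents are orthogonal: one is orthogonal to no nonzero
  idempotent, and a nonzero idempotent is not orthogonal to itself. Thus \<open>Cl2\<close> of the ring is
  the \<open>(t, m)\<close>-shuriken of the idempotent graph (\<open>Cl2_iso_shuriken\<close>).

  For integers modulo \<open>n\<close> it remains to count. The number of units is Euler's totient of \<open>n\<close>,
  which is the product in the statement. The number \<open>t\<close> of square roots of one is multiplicative
  over coprime moduli by the Chinese remainder theorem (\<open>card_roots_of_one_mult\<close>); it is \<open>2\<close>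
  for powers of odd primes, and \<open>1\<close>, \<open>2\<close>, \<open>4\<close> for the moduli \<open>2\<close>, \<open>4\<close> and the
  higher powers of two. Multiplying these over the \<open>k\<close> prime powers gives the three cases
  (\<open>card_roots_of_one_factored\<close>).
\<close>

section \<open>Numbering a finite set along an involution\<close>

text \<open>
  The pairing of the copies in a shuriken graph: the first \<open>t\<close> copies are matched with
  themselves and the others are reflected in the middle of \<open>t + 1, \<dots>, n\<close>.
\<close>

definition mirror :: "nat \<Rightarrow> nat \<Rightarrow> nat \<Rightarrow> nat" where
  "mirror t n i = (if i \<le> t then i else n + t + 1 - i)"

text \<open>
  The elements moved by \<open>\<iota>\<close> fall into pairs. Choosing one element from each pair gives \<open>h\<close>
  representatives; these receive the numbers \<open>t + 1, \<dots>, t + h\<close> after the \<open>t\<close> fixed points,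
  and their partners receive the reflected numbers.
\<close>

lemma involution_enumeration:
  fixes \<iota> :: "'a \<Rightarrow> 'a"
  assumes fin: "finite U"
    and closed: "\<And>u. u \<in> U \<Longrightarrow> \<iota> u \<in> U"
    and invol: "\<And>u. u \<in> U \<Longrightarrow> \<iota> (\<iota> u) = u"
  defines "t \<equiv> card {u \<in> U. \<iota> u = u}"
  obtains \<sigma> where "t \<le> card U" "even (card U - t)" "bij_betw \<sigma> {1..card U} U"
    "\<And>i. i \<in> {1..card U} \<Longrightarrow> \<iota> (\<sigma> i) = \<sigma> (mirror t (card U) i)"
proof -
  (* An arbitrary injection into the naturals decides which element represents each pair. *)
  obtain r :: "'a \<Rightarrow> nat" where r: "inj_on r U"
    using finite_imp_inj_to_nat_seg[OF fin] by blast
  define F where "F = {u \<in> U. \<iota> u = u}"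
  define L where "L = {u \<in> U. r u < r (\<iota> u)}"
  define H where "H = {u \<in> U. r (\<iota> u) < r u}"
  have fin': "finite F" "finite L" "finite H"
    using fin by (auto simp: F_def L_def H_def)
  have U: "U = F \<union> L \<union> H"
  proof -
    have "u \<in> F \<union> L \<union> H" if "u \<in> U" for u
      using that closed[OF that] inj_onD[OF r, of "\<iota> u" u]
      by (cases "r u" "r (\<iota> u)" rule: linorder_cases) (auto simp: F_def L_def H_def)
    then show ?thesis by (auto simp: F_def L_def H_def)
  qed
  have disj: "F \<inter> L = {}" "(F \<union> L) \<inter> H = {}"
    by (auto simp: F_def L_def H_def)
  have bij_\<iota>: "bij_betw \<iota> L H"
    by (rule bij_betw_byWitness[where f' = \<iota>]) (auto simp: L_def H_def closed invol)
  define h where "h = card L"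
  have card_H: "card H = h"
    using bij_betw_same_card[OF bij_\<iota>] by (simp add: h_def)
  have t: "card F = t" by (simp add: t_def F_def)
  have "card U = card (F \<union> L) + card H"
    unfolding U by (rule card_Un_disjoint) (use fin' disj in auto)
  also have "card (F \<union> L) = card F + card L"
    by (rule card_Un_disjoint) (use fin' disj in auto)
  finally have card_U: "card U = t + 2 * h"
    by (simp add: card_H t h_def)
  obtain \<alpha> where \<alpha>: "bij_betw \<alpha> {1..t} F"
    using ex_bij_betw_nat_finite_1[OF fin'(1)] t by auto
  have "card {t + 1..t + h} = card L" by (simp add: h_def)
  then obtain \<beta> where \<beta>: "bij_betw \<beta> {t + 1..t + h} L"
    using finite_same_card_bij[OF _ fin'(2)] by blast
  define \<sigma> where "\<sigma> i = (if i \<le> t then \<alpha> i else if i \<le> t + h then \<beta> i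
    else \<iota> (\<beta> (mirror t (t + 2 * h) i)))" for i
  have bF: "bij_betw \<sigma> {1..t} F"
    using \<alpha> by (rule bij_betw_cong[THEN iffD1, rotated]) (simp add: \<sigma>_def)
  have bL: "bij_betw \<sigma> {t + 1..t + h} L"
    using \<beta> by (rule bij_betw_cong[THEN iffD1, rotated]) (simp add: \<sigma>_def)
  have "bij_betw (mirror t (t + 2 * h)) {t + h + 1..t + 2 * h} {t + 1..t + h}"
    by (rule bij_betw_byWitness[where f' = "mirror t (t + 2 * h)"]) (auto simp: mirror_def)
  from bij_betw_trans[OF bij_betw_trans[OF this \<beta>] bij_\<iota>]
  have bH: "bij_betw \<sigma> {t + h + 1..t + 2 * h} H"
    by (rule bij_betw_cong[THEN iffD1, rotated]) (simp add: \<sigma>_def)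
  have "bij_betw \<sigma> ({1..t} \<union> {t + 1..t + h} \<union> {t + h + 1..t + 2 * h}) U"
    unfolding U by (intro bij_betw_combine bF bL bH disj)
  also have "{1..t} \<union> {t + 1..t + h} \<union> {t + h + 1..t + 2 * h} = {1..card U}"
    by (auto simp: card_U)
  finally have bij: "bij_betw \<sigma> {1..card U} U" .
  have "\<iota> (\<sigma> i) = \<sigma> (mirror t (card U) i)" if i: "i \<in> {1..card U}" for i
  proof -
    consider "i \<le> t" | "t < i" "i \<le> t + h" | "t + h < i" by linarith
    then show ?thesis
    proof cases
      case 1
      then have "\<sigma> i \<in> F" using bij_betwE[OF bF] i by auto
      then show ?thesis using 1 by (simp add: F_def mirror_def)
    next
      case 2
      then have "t + h < mirror t (t + 2 * h) i" "mirror t (t + 2 * h) (mirror t (t + 2 * h) i) = i"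
        by (auto simp: mirror_def)
      then show ?thesis using 2 by (simp add: \<sigma>_def card_U)
    next
      case 3
      define j where "j = mirror t (t + 2 * h) i"
      have j: "j \<in> {t + 1..t + h}"
        using 3 i by (auto simp: j_def mirror_def card_U)
      then have "\<beta> j \<in> U" using bij_betwE[OF \<beta>] by (auto simp: L_def)
      moreover have "\<sigma> i = \<iota> (\<beta> j)" using 3 by (simp add: \<sigma>_def j_def)
      moreover have "\<sigma> j = \<beta> j" using j by (simp add: \<sigma>_def)
      ultimately show ?thesis by (simp add: invol j_def card_U)
    qed
  qed
  with bij that show ?thesis by (simp add: card_U)
qed

section \<open>Shuriken graphs and clean graphs\<close>

text \<open>
  Since \<open>n - t\<close> is even, no copy after the first \<open>t\<close> is its own mirror image, so both kinds of
  edges not coming from \<open>G\<close> are described by the mirror at once, and only the first \<open>t\<close> copies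
  need the condition that the end points differ.
\<close>

lemma shuriken_adjacent_iff:
  assumes "sym (parcs G)" and tn: "t \<le> n" "even (n - t)"
    and V: "x \<in> insert None (Some ` pverts G)" "y \<in> insert None (Some ` pverts G)"
    and ij: "i \<in> {1..n}" "j \<in> {1..n}"
  shows "((x, i), (y, j)) \<in> parcs (shuriken t n G) \<longleftrightarrow>
    (\<exists>u v. x = Some u \<and> y = Some v \<and> (u, v) \<in> parcs G) \<or>
    ((x, i) \<noteq> (y, j) \<and> j = mirror t n i)"
proof -
  obtain h where n: "n = t + 2 * h"
    using tn by (metis dvdE le_add_diff_inverse)
  have sym: "(v, u) \<in> parcs G \<longleftrightarrow> (u, v) \<in> parcs G" for u v
    using assms(1) by (auto dest: symD)
  let ?E3 = "\<lambda>i j. i \<in> {t + 1..t + h} \<and> j = n + t + 1 - i"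
  have "?E3 i j \<or> ?E3 j i \<longleftrightarrow> t < i \<and> j = mirror t n i"
    using ij by (auto simp: mirror_def n)
  moreover have "i \<noteq> mirror t n i" if "t < i"
    using that ij unfolding mirror_def n by simp presburger
  moreover have "((x, i), (y, j)) \<in> parcs (shuriken t n G) \<longleftrightarrow>
    (\<exists>u v. x = Some u \<and> y = Some v \<and> (u, v) \<in> parcs G) \<or>
    (x \<noteq> y \<and> i = j \<and> i \<le> t) \<or> (?E3 i j \<or> ?E3 j i)"
    using V ij by (auto simp: shuriken_def Let_def sym n)
  ultimately show ?thesis
    using ij by (auto simp: mirror_def)
qed

text \<open>
  The isomorphism sends the copy \<open>e\<^sub>i\<close> to \<open>(e, \<sigma> i)\<close> and \<open>z\<^sub>i\<close> to \<open>(\<one>, \<sigma> i)\<close>,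
  where \<open>\<sigma>\<close> numbers the units along inversion.
\<close>

lemma (in ring) Cl2_iso_shuriken:
  assumes fin: "finite (Units R)" and nontrivial: "\<one> \<noteq> \<zero>"
  shows "digraph_iso (with_proj (Cl2 R))
    (with_proj (shuriken (card {u \<in> Units R. u \<otimes> u = \<one>}) (card (Units R)) (idempotent_graph R)))"
proof -
  define n t where "n = card (Units R)" and "t = card {u \<in> Units R. u \<otimes> u = \<one>}"
  define I where "I = idempotents R - {\<zero>, \<one>}"
  have inverse_iff: "u \<otimes> v = \<one> \<and> v \<otimes> u = \<one> \<longleftrightarrow> v = inv u"
    if "u \<in> Units R" "v \<in> Units R" for u v
    using that inv_unique'[of u v] by auto
  have "{u \<in> Units R. inv u = u} = {u \<in> Units R. u \<otimes> u = \<one>}"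
    using inverse_iff by metis
  with fin obtain \<sigma> where tn: "t \<le> n" "even (n - t)" and \<sigma>: "bij_betw \<sigma> {1..n} (Units R)"
    and inv_\<sigma>: "\<And>i. i \<in> {1..n} \<Longrightarrow> inv (\<sigma> i) = \<sigma> (mirror t n i)"
    using involution_enumeration[of "Units R" "m_inv R"] unfolding n_def t_def
    by (metis (no_types, lifting) Units_inv_Units Units_inv_inv)
  define c where "c x = (case x of None \<Rightarrow> \<one> | Some e \<Rightarrow> e)" for x
  define S where "S = shuriken t n (idempotent_graph R)"
  have pverts_I: "pverts (idempotent_graph R) = I"
    by (simp add: idempotent_graph_def I_def Let_def)
  have arcs_I: "(e, f) \<in> parcs (idempotent_graph R) \<longleftrightarrow>
      e \<in> I \<and> f \<in> I \<and> e \<otimes> f = \<zero> \<and> f \<otimes> e = \<zero>" for e f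
    by (auto simp: idempotent_graph_def I_def Let_def idempotents_def)
  have I_carrier: "e \<in> carrier R" "e \<noteq> \<zero>" if "e \<in> I" for e
    using that by (auto simp: I_def idempotents_def)
  have pverts_S: "pverts S = insert None (Some ` I) \<times> {1..n}"
    by (simp add: S_def shuriken_def Let_def pverts_I)
  have pverts_Cl2: "pverts (Cl2 R) = (idempotents R - {\<zero>}) \<times> Units R"
    by (simp add: Cl2_def Let_def)
  have c: "bij_betw c (insert None (Some ` I)) (idempotents R - {\<zero>})"
    by (rule bij_betw_byWitness[where f' = "\<lambda>e. if e = \<one> then None else Some e"])
      (use nontrivial in \<open>auto simp: c_def I_def idempotents_def\<close>)
  have bij: "bij_betw (map_prod c \<sigma>) (pverts S) (pverts (Cl2 R))"
    unfolding pverts_S pverts_Cl2 by (rule bij_betw_map_prod[OF c \<sigma>])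
  have adj: "(p, q) \<in> parcs S \<longleftrightarrow> (map_prod c \<sigma> p, map_prod c \<sigma> q) \<in> parcs (Cl2 R)"
    if pq: "p \<in> pverts S" "q \<in> pverts S" for p q
  proof -
    obtain x i y j where p: "p = (x, i)" and q: "q = (y, j)" by fastforce
    have x: "x \<in> insert None (Some ` I)" "i \<in> {1..n}" and y: "y \<in> insert None (Some ` I)" "j \<in> {1..n}"
      using pq by (auto simp: p q pverts_S)
    have mirror_i: "mirror t n i \<in> {1..n}"
      using x(2) by (auto simp: mirror_def)
    have units: "\<sigma> i \<in> Units R" "\<sigma> j \<in> Units R"
      using bij_betwE[OF \<sigma>] x y by auto
    have "\<sigma> i \<otimes> \<sigma> j = \<one> \<and> \<sigma> j \<otimes> \<sigma> i = \<one> \<longleftrightarrow> j = mirror t n i"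
      using inverse_iff[OF units] inv_\<sigma>[OF x(2)] bij_betw_imp_inj_on[OF \<sigma>] mirror_i y(2)
      by (simp add: inj_on_eq_iff)
    moreover have "c x \<otimes> c y = \<zero> \<and> c y \<otimes> c x = \<zero> \<longleftrightarrow>
      (\<exists>e f. x = Some e \<and> y = Some f \<and> (e, f) \<in> parcs (idempotent_graph R))"
      using x y nontrivial I_carrier by (auto simp: c_def arcs_I)
    moreover have "p \<noteq> q \<longleftrightarrow> map_prod c \<sigma> p \<noteq> map_prod c \<sigma> q"
      using bij_betw_imp_inj_on[OF bij] pq by (simp add: inj_on_eq_iff)
    moreover have "map_prod c \<sigma> p \<in> pverts (Cl2 R)" "map_prod c \<sigma> q \<in> pverts (Cl2 R)"
      using bij_betwE[OF bij] pq by auto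
    moreover have "x \<noteq> y" if "(e, e') \<in> parcs (idempotent_graph R)" "x = Some e" "y = Some e'" for e e'
      using that by (auto simp: idempotent_graph_def Let_def)
    moreover have "sym (parcs (idempotent_graph R))"
      by (auto simp: sym_def arcs_I)
    ultimately show ?thesis
      using shuriken_adjacent_iff[of "idempotent_graph R" t n x y i j] tn x y
      unfolding p q S_def pverts_I
      by (auto simp: Cl2_def Let_def)
  qed
  have "pair_wf_digraph S" "pair_wf_digraph (Cl2 R)"
    using pair_bidirected_digraph_shuriken[OF pair_bidirected_digraph_idempotent_graph tn(1)]
      pair_bidirected_digraph_Cl2
    unfolding S_def pair_bidirected_digraph_def pair_loopfree_digraph_def
      pair_fin_digraph_def by auto
  then have "digraph_iso (with_proj S) (with_proj (Cl2 R))"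
    using bij adj by (subst digraph_iso_with_proj_iff) blast+
  then show ?thesis
    using digraph_iso_swap[OF iffD2[OF wf_digraph_wp_iff \<open>pair_wf_digraph S\<close>]]
    by (simp add: S_def n_def t_def)
qed

section \<open>Square roots of one modulo n\<close>

text \<open>
  The defining condition is \<open>x\<^sup>2 = 1\<close> modulo \<open>q\<close>, factored because the counts for prime powers
  come from distributing the prime over the two factors.
\<close>

definition roots_of_one :: "int \<Rightarrow> int set" where
  "roots_of_one q = {x \<in> {0..<q}. q dvd (x - 1) * (x + 1)}"

lemma roots_of_one_iff_cong:
  "x \<in> roots_of_one q \<longleftrightarrow> x \<in> {0..<q} \<and> [x * x = 1] (mod q)"
  by (simp add: roots_of_one_def cong_iff_dvd_diff algebra_simps)

text \<open>
  The Chinese remainder bijection respects multiplication, hence restricts to the square roots of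
  one.
\<close>

lemma card_roots_of_one_mult:
  assumes "coprime a b" "a > 0" "b > 0"
  shows "card (roots_of_one (a * b)) = card (roots_of_one a) * card (roots_of_one b)"
proof -
  let ?f = "\<lambda>x. (x mod a, x mod b)"
  have ab: "[x = y] (mod a * b) \<longleftrightarrow> [x = y] (mod a) \<and> [x = y] (mod b)" for x y
    using assms(1) by (metis coprime_cong_mult cong_modulus_mult mult.commute)
  have sq: "[(x mod q) * (x mod q) = 1] (mod q) \<longleftrightarrow> [x * x = 1] (mod q)" for x q :: int
    by (simp add: cong_def mod_mult_eq)
  have "bij_betw ?f (roots_of_one (a * b)) (roots_of_one a \<times> roots_of_one b)"
    unfolding bij_betw_def
  proof
    show "inj_on ?f (roots_of_one (a * b))"
    proof (rule inj_onI)
      fix x y assume xy: "x \<in> roots_of_one (a * b)" "y \<in> roots_of_one (a * b)" "?f x = ?f y"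
      then have "[x = y] (mod a * b)" using ab by (simp add: cong_def)
      then show "x = y" using xy by (auto simp: roots_of_one_def intro: cong_less_imp_eq_int)
    qed
    show "?f ` roots_of_one (a * b) = roots_of_one a \<times> roots_of_one b"
    proof (intro equalityI subsetI)
      fix z assume "z \<in> ?f ` roots_of_one (a * b)"
      then show "z \<in> roots_of_one a \<times> roots_of_one b"
        using assms by (auto simp: roots_of_one_iff_cong ab sq)
    next
      fix z assume z: "z \<in> roots_of_one a \<times> roots_of_one b"
      obtain u v where uv: "z = (u, v)" "u \<in> roots_of_one a" "v \<in> roots_of_one b"
        using z by auto
      obtain w where w: "[w = u] (mod a)" "[w = v] (mod b)"
        using binary_chinese_remainder_int[OF assms(1)] by blast
      define x where "x = w mod (a * b)"
      have "[x = w] (mod a * b)" by (simp add: x_def cong_def)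
      then have x: "[x = u] (mod a)" "[x = v] (mod b)"
        using w ab cong_trans by blast+
      then have "[x * x = 1] (mod a)" "[x * x = 1] (mod b)"
        using uv cong_mult[of x u a x u] cong_mult[of x v b x v] cong_trans
        unfolding roots_of_one_iff_cong by blast+
      moreover have "x \<in> {0..<a * b}" using assms by (simp add: x_def)
      ultimately have "x \<in> roots_of_one (a * b)" by (simp add: roots_of_one_iff_cong ab)
      moreover have "?f x = z"
        using x uv by (simp add: cong_def roots_of_one_def)
      ultimately show "z \<in> ?f ` roots_of_one (a * b)" by blast
    qed
  qed
  then show ?thesis
    by (simp add: bij_betw_same_card card_cartesian_product)
qed

text \<open>
  An odd prime cannot divide both \<open>x - 1\<close> and \<open>x + 1\<close>, whose difference is \<open>2\<close>, so the whole
  prime power divides one of them. This leaves only \<open>1\<close> and \<open>-1\<close>, which are distinct since the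
  modulus exceeds \<open>2\<close>.
\<close>

lemma card_roots_of_one_odd_prime_power:
  fixes p :: int
  assumes p: "prime p" "odd p" and a: "a > 0"
  shows "card (roots_of_one (p ^ a)) = 2"
proof -
  define q where "q = p ^ a"
  have "p > 2" using p by (metis prime_ge_2_int dvd_refl order_le_less)
  have "p dvd q" using a by (simp add: q_def)
  moreover have "q > 0" using \<open>p > 2\<close> by (simp add: q_def)
  ultimately have q: "q > 2" using \<open>p > 2\<close> zdvd_imp_le by fastforce
  have "q dvd (x - 1) * (x + 1) \<longleftrightarrow> q dvd x - 1 \<or> q dvd x + 1" for x
  proof
    assume *: "q dvd (x - 1) * (x + 1)"
    have "\<not> (p dvd x - 1 \<and> p dvd x + 1)"
    proof
      assume "p dvd x - 1 \<and> p dvd x + 1"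
      then have "p dvd (x + 1) - (x - 1)" by (blast intro: dvd_diff)
      then show False using \<open>p > 2\<close> zdvd_imp_le[of p 2] by simp
    qed
    moreover have "p ^ a dvd (x - 1) * (x + 1)" "p ^ a dvd (x + 1) * (x - 1)"
      using * by (simp_all add: q_def mult.commute[of "x + 1"])
    ultimately show "q dvd x - 1 \<or> q dvd x + 1"
      using prime_power_dvd_multD[of p a "x - 1" "x + 1"]
        prime_power_dvd_multD[of p a "x + 1" "x - 1"] p a
      unfolding q_def by blast
  qed auto
  moreover have "q dvd x - 1 \<longleftrightarrow> x = 1" if "0 \<le> x" "x < q" for x
  proof
    assume *: "q dvd x - 1"
    have "x \<noteq> 0" using * q zdvd_imp_le[of q 1] by auto
    then show "x = 1" using * that zdvd_imp_le[of q "x - 1"] by linarith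
  qed simp
  moreover have "q dvd x + 1 \<longleftrightarrow> x = q - 1" if "0 \<le> x" "x < q" for x
  proof
    assume "q dvd x + 1"
    then show "x = q - 1" using that zdvd_imp_le[of q "x + 1"] by linarith
  qed simp
  ultimately have "roots_of_one q = {1, q - 1}"
    using q by (auto simp: roots_of_one_def)
  then show ?thesis using q by (simp add: q_def)
qed

text \<open>
  Write the modulus as \<open>2h\<close>. For a root \<open>x\<close> both \<open>x - 1\<close> and \<open>x + 1\<close> are even, but
  one of them is not divisible by \<open>4\<close> and accounts for a single factor of two; hence \<open>h\<close> divides
  the other one. The four resulting residues \<open>1\<close>, \<open>h + 1\<close>, \<open>h - 1\<close>, \<open>2h - 1\<close> are distinct
  because \<open>h \<ge> 4\<close>.
\<close>

lemma card_roots_of_one_power_of_two: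
  assumes "a \<ge> 3"
  shows "card (roots_of_one (2 ^ a)) = 4"
proof -
  obtain b where b: "a = b + 3" using assms by (metis add.commute le_Suc_ex)
  define h :: int where "h = 2 ^ (b + 2)"
  have q: "2 ^ a = 2 * h" and h: "h = 4 * 2 ^ b" by (simp_all add: h_def b power_add)
  have "h \<ge> 4" using h by simp
  have "2 * h dvd (x - 1) * (x + 1) \<longleftrightarrow> h dvd x - 1 \<or> h dvd x + 1" for x
  proof
    assume *: "2 * h dvd (x - 1) * (x + 1)"
    have "even ((x - 1) * (x + 1))" using * dvd_mult_left by blast
    then obtain y where x: "x = 2 * y + 1" by (auto elim: oddE)
    (* The consecutive numbers y and y + 1 are not both even, so the power of two divides one. *)
    have "8 * 2 ^ b dvd 4 * (y * (y + 1))" using * by (simp add: x h algebra_simps)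
    then have **: "2 * 2 ^ b dvd y * (y + 1)" using dvd_times_left_cancel_iff[of 4 "2 * 2 ^ b" "y * (y + 1)"] by simp
    have "2 ^ Suc b dvd y \<or> 2 ^ Suc b dvd y + 1"
      using prime_power_dvd_multD[of 2 "Suc b" y "y + 1"]
        prime_power_dvd_multD[of 2 "Suc b" "y + 1" y] **
      by (auto simp: mult.commute)
    then have "2 * 2 ^ Suc b dvd 2 * y \<or> 2 * 2 ^ Suc b dvd 2 * (y + 1)"
      by (metis dvd_refl mult_dvd_mono)
    then show "h dvd x - 1 \<or> h dvd x + 1" by (simp add: x h algebra_simps)
  next
    assume "h dvd x - 1 \<or> h dvd x + 1"
    moreover have "even h" by (simp add: h)
    ultimately show "2 * h dvd (x - 1) * (x + 1)"
    proof (elim disjE)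
      assume *: "h dvd x - 1"
      then have "even (x - 1)" using \<open>even h\<close> dvd_trans by blast
      then have "2 dvd x + 1" by simp
      then show ?thesis using * mult_dvd_mono[of h "x - 1" 2 "x + 1"] by (simp add: mult.commute)
    next
      assume *: "h dvd x + 1"
      then have "even (x + 1)" using \<open>even h\<close> dvd_trans by blast
      then have "2 dvd x - 1" by simp
      then show ?thesis using * mult_dvd_mono[of 2 "x - 1" h "x + 1"] by simp
    qed
  qed
  moreover have "h dvd x - 1 \<longleftrightarrow> x = 1 \<or> x = h + 1" "h dvd x + 1 \<longleftrightarrow> x = h - 1 \<or> x = 2 * h - 1"
    if "0 \<le> x" "x < 2 * h" for x
  proof -
    (* The range covers both z = x - 1 and z = x + 1. *)
    have mult: "h dvd z \<longleftrightarrow> z = 0 \<or> z = h \<or> z = 2 * h" if z: "- h < z" "z \<le> 2 * h" for z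
    proof
      assume "h dvd z"
      then obtain k where k: "z = h * k" by (elim dvdE)
      have "- 1 < k"
        using z(1) \<open>h \<ge> 4\<close> mult_left_mono[of k "- 1" h] by (cases "- 1 < k") (simp_all add: k)
      moreover have "k \<le> 2"
        using z(2) \<open>h \<ge> 4\<close> by (simp add: k mult.commute[of 2])
      ultimately show "z = 0 \<or> z = h \<or> z = 2 * h" unfolding k by force
    qed auto
    show "h dvd x - 1 \<longleftrightarrow> x = 1 \<or> x = h + 1" "h dvd x + 1 \<longleftrightarrow> x = h - 1 \<or> x = 2 * h - 1"
      using that \<open>h \<ge> 4\<close> by (subst mult; presburger)+
  qed
  ultimately have "roots_of_one (2 * h) = {1, h + 1, h - 1, 2 * h - 1}"
    using \<open>h \<ge> 4\<close> by (auto simp: roots_of_one_def)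
  then show ?thesis using \<open>h \<ge> 4\<close> by (simp add: q)
qed

lemma card_roots_of_one_small:
  "card (roots_of_one 1) = 1" "card (roots_of_one 2) = 1" "card (roots_of_one 4) = 2"
proof -
  have "roots_of_one 1 = {0}" by (auto simp: roots_of_one_def)
  moreover have "{0..<2} = {0, 1 :: int}" "{0..<4} = {0, 1, 2, 3 :: int}" by auto
  then have "roots_of_one 2 = {1}" "roots_of_one 4 = {1, 3}"
    by (auto simp: roots_of_one_def)
  ultimately show "card (roots_of_one 1) = 1" "card (roots_of_one 2) = 1" "card (roots_of_one 4) = 2"
    by simp_all
qed

lemma card_roots_of_one_prod:
  fixes f :: "'i \<Rightarrow> nat"
  assumes "finite A" "\<And>i. i \<in> A \<Longrightarrow> f i > 0"
    "\<And>i j. i \<in> A \<Longrightarrow> j \<in> A \<Longrightarrow> i \<noteq> j \<Longrightarrow> coprime (f i) (f j)"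
  shows "card (roots_of_one (int (prod f A))) = (\<Prod>i\<in>A. card (roots_of_one (int (f i))))"
  using assms
proof (induction A rule: finite_induct)
  case empty
  then show ?case by (simp add: card_roots_of_one_small)
next
  case (insert x A)
  have "coprime (f x) (prod f A)"
    using insert.prems(2) insert.hyps by (intro prod_coprime_right) auto
  then have "coprime (int (f x)) (int (prod f A))"
    using coprime_int_iff by blast
  moreover have "int (prod f A) > 0" "int (f x) > 0"
    using insert.prems(1) by (simp_all add: prod_pos del: of_nat_prod)
  ultimately show ?case
    using insert card_roots_of_one_mult[of "int (f x)" "int (prod f A)"] by simp
qed

text \<open>
  Every odd prime contributes a factor \<open>2\<close>. If \<open>2\<close> is among the primes, its exponent decides
  which of \<open>1\<close>, \<open>2\<close>, \<open>4\<close> replaces that factor, and this exponent is read off from the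
  divisibility of \<open>n\<close> by \<open>2\<close>, \<open>4\<close> and \<open>8\<close>.
\<close>

lemma card_roots_of_one_factored:
  fixes n k :: nat and p a :: "nat \<Rightarrow> nat"
  assumes p: "\<forall>i\<in>{1..k}. prime (p i)" and inj: "inj_on p {1..k}"
    and a: "\<forall>i\<in>{1..k}. a i > 0" and n: "n = (\<Prod>i=1..k. p i ^ a i)"
  shows "card (roots_of_one (int n)) =
    (if 2 dvd n \<and> \<not> 4 dvd n then 2 ^ (k - 1) else if 8 dvd n then 2 ^ (k + 1) else 2 ^ k)"
proof -
  let ?r = "\<lambda>i. card (roots_of_one (int (p i ^ a i)))"
  have cop: "coprime (p i ^ a i) (p j ^ a j)" if "i \<in> {1..k}" "j \<in> {1..k}" "i \<noteq> j" for i j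
    using that p inj by (metis primes_coprime coprime_power_left_iff coprime_power_right_iff inj_onD)
  have card_n: "card (roots_of_one (int n)) = (\<Prod>i=1..k. ?r i)"
    unfolding n by (rule card_roots_of_one_prod) (use p cop in \<open>auto simp: prime_gt_0_nat\<close>)
  have odd_r: "?r i = 2" if "i \<in> {1..k}" "p i \<noteq> 2" for i
  proof -
    have "odd (p i)" using that p primes_dvd_imp_eq[of 2 "p i"] by auto
    then show ?thesis
      using that p a card_roots_of_one_odd_prime_power[of "int (p i)" "a i"] by simp
  qed
  show ?thesis
  proof (cases "\<exists>j\<in>{1..k}. p j = 2")
    case False
    then have "odd n"
      unfolding n using p by (auto simp: prime_dvd_prod_iff dest: prime_dvd_power primes_dvd_imp_eq[rotated 2])
    moreover have "\<not> 8 dvd n" using \<open>odd n\<close> by presburger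
    moreover have "(\<Prod>i=1..k. ?r i) = 2 ^ k"
      using False odd_r by (subst prod.cong[OF refl odd_r]) auto
    ultimately show ?thesis by (simp add: card_n)
  next
    case True
    then obtain j where j: "j \<in> {1..k}" "p j = 2" by blast
    have other: "p i \<noteq> 2" if "i \<in> {1..k} - {j}" for i
      using that inj j by (metis DiffD1 DiffD2 inj_onD insertI1)
    define b where "b = (\<Prod>i\<in>{1..k} - {j}. p i ^ a i)"
    have n_eq: "n = 2 ^ a j * b"
      unfolding n b_def using j by (simp add: prod.remove)
    have "coprime (2 ^ a j) b"
      unfolding b_def using cop j by (intro prod_coprime_right) (metis DiffD1 DiffD2 insertI1)
    moreover have "a j > 0" using a j by blast
    ultimately have "odd b" by simp
    then have dvd_n: "2 ^ e dvd n \<longleftrightarrow> e \<le> a j" for e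
      unfolding n_eq by (subst coprime_dvd_mult_left_iff) (auto dest: power_dvd_imp_le intro: le_imp_power_dvd)
    have "(\<Prod>i\<in>{1..k} - {j}. ?r i) = (\<Prod>i\<in>{1..k} - {j}. 2)"
      using odd_r other by (intro prod.cong) auto
    also have "\<dots> = 2 ^ (k - 1)" using j by simp
    finally have card_n': "card (roots_of_one (int n)) = card (roots_of_one (2 ^ a j)) * 2 ^ (k - 1)"
      unfolding card_n using j by (simp add: prod.remove)
    obtain l where k: "k = Suc l" using j by (cases k) auto
    consider "a j = 1" | "a j = 2" | "a j \<ge> 3" using a j by force
    then show ?thesis
    proof cases
      case 1
      then show ?thesis
        using dvd_n[of 1] dvd_n[of 2] card_n' by (simp add: card_roots_of_one_small)
    next
      case 2
      then show ?thesis
        using dvd_n[of 2] dvd_n[of 3] card_n' by (simp add: card_roots_of_one_small k)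
    next
      case 3
      then show ?thesis
        using dvd_n[of 2] dvd_n[of 3] card_n' by (simp add: card_roots_of_one_power_of_two k)
    qed
  qed
qed

section \<open>Residue rings\<close>

theorem corollary1:
  fixes n k m :: nat and p a :: "nat \<Rightarrow> nat"
  assumes "n \<ge> 2"
    and "\<forall>i\<in>{1..k}. prime (p i)"
    and "inj_on p {1..k}"
    and "\<forall>i\<in>{1..k}. a i > 0"
    and "n = (\<Prod>i=1..k. p i ^ a i)"
    and "m = (\<Prod>i=1..k. p i ^ a i - p i ^ (a i - 1))"
  defines "R \<equiv> residue_ring (int n)"
  shows "digraph_iso (with_proj (Cl2 R))
    (with_proj (shuriken
      (if 2 dvd n \<and> \<not> 4 dvd n then 2 ^ (k - 1)
       else if 8 dvd n then 2 ^ (k + 1)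
       else 2 ^ k)
      m (idempotent_graph R)))"
proof -
  interpret R: residues "int n" R
    using assms(1) by unfold_locales (auto simp: R_def)
  (* An element whose square is one is a unit, so the root condition alone selects these units. *)
  have "{u \<in> Units R. u \<otimes>\<^bsub>R\<^esub> u = \<one>\<^bsub>R\<^esub>} = roots_of_one (int n)"
  proof -
    have "u \<in> Units R" if "u \<in> carrier R" "u \<otimes>\<^bsub>R\<^esub> u = \<one>\<^bsub>R\<^esub>" for u
      using that by (auto simp: Units_def)
    then have "{u \<in> Units R. u \<otimes>\<^bsub>R\<^esub> u = \<one>\<^bsub>R\<^esub>} = {u \<in> carrier R. u \<otimes>\<^bsub>R\<^esub> u = \<one>\<^bsub>R\<^esub>}"
      using R.Units_closed by blast
    also have "\<dots> = roots_of_one (int n)"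
      using assms(1) by (auto simp: R.res_carrier_eq R.res_mult_eq R.res_one_eq
          roots_of_one_iff_cong cong_def)
    finally show ?thesis .
  qed
  moreover have "card (Units R) = m"
  proof -
    have "card (Units R) = totient n" using R.totient_eq by simp
    also have "\<dots> = (\<Prod>i=1..k. totient (p i ^ a i))"
      unfolding assms(5)
    proof (rule totient_prod_coprime)
      show "inj_on (\<lambda>i. p i ^ a i) {1..k}"
      proof (rule inj_onI)
        fix i j assume ij: "i \<in> {1..k}" "j \<in> {1..k}" "p i ^ a i = p j ^ a j"
        have "p i = p j"
          by (rule prime_power_eq_imp_eq[of _ _ "a i" "a j"]) (use ij assms(2,4) in auto)
        then show "i = j" using ij assms(3) by (simp add: inj_on_eq_iff)
      qed
      show "pairwise coprime ((\<lambda>i. p i ^ a i) ` {1..k})"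
      proof (rule pairwiseI)
        fix x y assume "x \<in> (\<lambda>i. p i ^ a i) ` {1..k}" "y \<in> (\<lambda>i. p i ^ a i) ` {1..k}" "x \<noteq> y"
        then obtain i j where "i \<in> {1..k}" "j \<in> {1..k}" "x = p i ^ a i" "y = p j ^ a j" "i \<noteq> j"
          by blast
        then show "coprime x y"
          using assms(2,3) primes_coprime[of "p i" "p j"] by (simp add: inj_on_eq_iff)
      qed
    qed
    also have "\<dots> = m"
      unfolding assms(6)
    proof (rule prod.cong[OF refl])
      fix i assume i: "i \<in> {1..k}"
      obtain b where b: "a i = Suc b" using assms(4) i by (metis gr0_implies_Suc)
      show "totient (p i ^ a i) = p i ^ a i - p i ^ (a i - 1)"
        unfolding b using assms(2) i
        by (subst totient_prime_power_Suc) (simp_all add: diff_mult_distrib2 mult.commute)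
    qed
    finally show ?thesis .
  qed
  ultimately show ?thesis
    using R.Cl2_iso_shuriken[OF R.finite_Units] card_roots_of_one_factored[OF assms(2-5)]
    by (simp add: R.res_one_eq R.res_zero_eq)
qed

end
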